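(* Consider the net-metering version of the linear program $(\mathcal{P}_1)$ defined in the context, in which power can be exported to the grid, i.e. $P_{\rm grid}^{(t)}$ is allowed to be negative. Assume $\alpha,\beta\geq 0$, $0<\eta_c<1<\eta_d$, and $c_e^{(t)}>0$ for all $t\in\{1,\dots,N\}$. Then every feasible point of this program for which the storage system simultaneously charges and discharges at some time, i.e. $0<P_{\rm ch}^{(t)}\leq P_{\rm ch,max}$ and $0<P_{\rm dis}^{(t)}\leq P_{\rm dis,max}$ for some $t\in\{1,\dots,N\}$, is suboptimal, i.e. is not a minimizer of the program.
   Context: Let $N\ge 1$ be an integer (prediction horizon) and $\Delta t>0$ a time step. The given real data are: prices $c_e^{(t)}$, loads $P_{\rm L,house}^{(t)}\ge 0$, and available solar power $P_{\rm sol}^{(t)}\ge 0$ for $t\in\{1,\dots,N\}$; charging and discharging power limits $P_{\rm ch,max}$ and $P_{\rm dis,max}$ (nonnegative); state-of-charge limits $E_{\rm min}\le E_{\rm max}$; initial state of charge $E^{0}$ with $E_{\rm min}\le E^0\le E_{\rm max}$; charging and discharging efficiencies $\eta_c,\eta_d$; penalty coefficients $\alpha,\beta$. The decision variables are $\underline{\mathbf{x}}_N=(\mathbf{x}^{(1)},\dots,\mathbf{x}^{(N)})\in\mathbb{R}^{4N}$ with $\mathbf{x}^{(t)}=(P_{\rm grid}^{(t)},P_{\rm ch}^{(t)},P_{\rm dis}^{(t)},P_{\rm c}^{(t)})$ (grid power, charging power, discharging power, curtailed solar power). The state of charge is determined by $E^{(1)}=E^0$ and $E^{(t+1)}=E^{(t)}+\eta_c\Delta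 t\,P_{\rm ch}^{(t)}-\eta_d\Delta t\,P_{\rm dis}^{(t)}$ for $t\in\{1,\dots,N\}$. The net-metering version of $(\mathcal{P}_1)$ is to minimize $$f_{\rm cost}(\underline{\mathbf{x}}_N)=\sum_{t=1}^{N}\left(c_e^{(t)}P_{\rm grid}^{(t)}+\alpha P_{\rm ch}^{(t)}+\beta P_{\rm dis}^{(t)}\right)$$ over $\underline{\mathbf{x}}_N$ subject to, for all $t\in\{1,\dots,N\}$ (with no sign constraint on $P_{\rm grid}^{(t)}$): - $0\le P_{\rm ch}^{(t)}\le P_{\rm ch,max}$; - $0\le P_{\rm dis}^{(t)}\le P_{\rm dis,max}$; - $E_{\rm min}\le E^{(t+1)}\le E_{\rm max}$; - $0\le P_{\rm c}^{(t)}\le P_{\rm sol}^{(t)}$; - $0=-P_{\rm grid}^{(t)}+P_{\rm L,house}^{(t)}-(P_{\rm sol}^{(t)}-P_{\rm c}^{(t)})-P_{\rm dis}^{(t)}+P_{\rm ch}^{(t)}$. *)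

theory Defs
  imports Complex_Main
begin

record storage_data =
  horizon :: nat
  dt :: real
  price :: "nat \<Rightarrow> real"
  load :: "nat \<Rightarrow> real"
  solar :: "nat \<Rightarrow> real"
  ch_max :: real
  dis_max :: real
  E_min :: real
  E_max :: real
  E_init :: real
  eta_c :: real
  eta_d :: real
  alpha :: real
  beta :: real

definition valid_data :: "storage_data \<Rightarrow> bool" where
  "valid_data d \<longleftrightarrow>
     horizon d \<ge> 1 \<and> dt d > 0 \<and>
     (\<forall>t\<in>{1..horizon d}. load d t \<ge> 0 \<and> solar d t \<ge> 0) \<and>
     ch_max d \<ge> 0 \<and> dis_max d \<ge> 0 \<and>
     E_min d \<le> E_max d \<and> E_min d \<le> E_init d \<and> E_init d \<le> E_max d"

record decision =
  P_grid :: real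
  P_ch :: real
  P_dis :: real
  P_c :: real

(* A point of the 4N-dimensional decision space is a function from time steps to decisions.
   Only its values at 1, ..., N enter the constraints and the cost. *)
type_synonym schedule = "nat \<Rightarrow> decision"

(* Time starts at 1; the value at 0 is a dummy and is never used. *)
fun soc :: "storage_data \<Rightarrow> schedule \<Rightarrow> nat \<Rightarrow> real" where
  "soc d x 0 = E_init d"
| "soc d x (Suc 0) = E_init d"
| "soc d x (Suc (Suc t)) =
     soc d x (Suc t) + eta_c d * dt d * P_ch (x (Suc t)) - eta_d d * dt d * P_dis (x (Suc t))"

definition f_cost :: "storage_data \<Rightarrow> schedule \<Rightarrow> real" where
  "f_cost d x =
     (\<Sum>t = 1..horizon d. price d t * P_grid (x t) + alpha d * P_ch (x t) + beta d * P_dis (x t))"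

(* Net metering: the sign of P_grid is unconstrained. *)
definition feasible :: "storage_data \<Rightarrow> schedule \<Rightarrow> bool" where
  "feasible d x \<longleftrightarrow>
     (\<forall>t\<in>{1..horizon d}.
        0 \<le> P_ch (x t) \<and> P_ch (x t) \<le> ch_max d \<and>
        0 \<le> P_dis (x t) \<and> P_dis (x t) \<le> dis_max d \<and>
        E_min d \<le> soc d x (t + 1) \<and> soc d x (t + 1) \<le> E_max d \<and>
        0 \<le> P_c (x t) \<and> P_c (x t) \<le> solar d t \<and>
        0 = - P_grid (x t) + load d t - (solar d t - P_c (x t)) - P_dis (x t) + P_ch (x t))"

end

theory Submission
  imports Defs
begin

text \<open>
  Lowering the charging power by \<open>\<eta>\<^sub>d s\<close> and the discharging power by \<open>\<eta>\<^sub>c s\<close> at the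
  offending time step leaves the state of charge unchanged at all times. The power balance
  then lowers the grid power by \<open>(\<eta>\<^sub>d - \<eta>\<^sub>c) s > 0\<close>, which strictly lowers the cost; under net
  metering the new grid power may be negative, so the modified schedule is still feasible.
\<close>

text \<open>Each step of the recursion adds \<open>dt d\<close> times the net stored power, so
  schedules that agree in this quantity have the same state of charge.\<close>

lemma soc_cong:
  assumes "\<And>t. eta_c d * P_ch (x t) - eta_d d * P_dis (x t)
             = eta_c d * P_ch (y t) - eta_d d * P_dis (y t)"
  shows "soc d x t = soc d y t"
  using assms
proof (induction d x t rule: soc.induct)
  case (3 d x t)
  have "dt d * (eta_c d * P_ch (x (Suc t)) - eta_d d * P_dis (x (Suc t)))
      = dt d * (eta_c d * P_ch (y (Suc t)) - eta_d d * P_dis (y (Suc t)))"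
    by (simp only: "3.prems")
  with 3 show ?case
    by (simp add: algebra_simps)
qed simp_all

definition shed :: "storage_data \<Rightarrow> real \<Rightarrow> decision \<Rightarrow> decision" where
  "shed d s u = u\<lparr>P_grid := P_grid u - (eta_d d - eta_c d) * s,
                  P_ch := P_ch u - eta_d d * s, P_dis := P_dis u - eta_c d * s\<rparr>"

lemma shed_simps [simp]:
  "P_grid (shed d s u) = P_grid u - (eta_d d - eta_c d) * s"
  "P_ch (shed d s u) = P_ch u - eta_d d * s"
  "P_dis (shed d s u) = P_dis u - eta_c d * s"
  "P_c (shed d s u) = P_c u"
  by (simp_all add: shed_def)

text \<open>At time \<open>t\<close> both storage terms drop by
  \<open>eta_c d * eta_d d * s\<close>, which cancels in their difference.\<close>

lemma soc_shed: "soc d (x(t := shed d s (x t))) = soc d x"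
  by (rule ext, rule soc_cong) (simp add: algebra_simps)

lemma feasible_shed:
  assumes "feasible d x" "0 \<le> s" "0 \<le> eta_c d" "0 \<le> eta_d d"
    and "eta_d d * s \<le> P_ch (x t)" "eta_c d * s \<le> P_dis (x t)"
  shows "feasible d (x(t := shed d s (x t)))"
proof -
  \<comment> \<open>Upper power limits survive, since both reductions are nonnegative.\<close>
  have "p - eta_d d * s \<le> q" "p - eta_c d * s \<le> q" if "p \<le> q" for p q
    using assms(2-4) that by (simp_all add: diff_le_eq add_increasing2)
  with assms(1,5,6) show ?thesis
    unfolding feasible_def soc_shed
    by (intro ballI) (drule bspec, assumption, auto simp: left_diff_distrib)
qed

text \<open>Only the summand at \<open>t\<close> changes: its price term strictly falls and its
  penalty terms do not rise.\<close>

lemma f_cost_shed_less: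
  assumes "t \<in> {1..horizon d}" "0 < s" "0 < price d t" "0 \<le> alpha d" "0 \<le> beta d"
    and "0 \<le> eta_c d" "eta_c d < eta_d d"
  shows "f_cost d (x(t := shed d s (x t))) < f_cost d x"
proof -
  have "0 < price d t * ((eta_d d - eta_c d) * s)" "0 \<le> alpha d * (eta_d d * s)"
    "0 \<le> beta d * (eta_c d * s)"
    using assms by simp_all
  then show ?thesis
    unfolding f_cost_def using assms(1)
    by (intro sum_strict_mono_ex1 bexI[of _ t]) (auto simp: right_diff_distrib)
qed

theorem proposition2:
  fixes d :: storage_data and x :: schedule
  assumes "valid_data d"
    and "alpha d \<ge> 0" and "beta d \<ge> 0"
    and "0 < eta_c d" and "eta_c d < 1" and "1 < eta_d d"
    and "\<forall>t\<in>{1..horizon d}. price d t > 0"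
    and "feasible d x"
    and "\<exists>t\<in>{1..horizon d}. 0 < P_ch (x t) \<and> P_ch (x t) \<le> ch_max d \<and>
           0 < P_dis (x t) \<and> P_dis (x t) \<le> dis_max d"
  shows "\<not> is_arg_min (f_cost d) (feasible d) x"
proof -
  obtain t where t: "t \<in> {1..horizon d}" "0 < P_ch (x t)" "0 < P_dis (x t)"
    using assms(9) by blast
  \<comment> \<open>The largest \<open>s\<close> that keeps both powers nonnegative; at least one of
    them becomes zero.\<close>
  define s where "s = min (P_ch (x t) / eta_d d) (P_dis (x t) / eta_c d)"
  have "0 < s"
    using t assms(4,6) by (simp add: s_def)
  moreover have "s \<le> P_ch (x t) / eta_d d" "s \<le> P_dis (x t) / eta_c d"
    by (simp_all add: s_def)
  then have "eta_d d * s \<le> P_ch (x t)" "eta_c d * s \<le> P_dis (x t)"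
    using assms(4,6) by (simp_all add: pos_le_divide_eq mult.commute)
  ultimately have "feasible d (x(t := shed d s (x t)))"
    "f_cost d (x(t := shed d s (x t))) < f_cost d x"
    using t assms by (simp_all add: feasible_shed f_cost_shed_less)
  then show ?thesis
    unfolding is_arg_min_def by blast
qed

end
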